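(* Let $n\ge1$. A skew brace $A$ belongs to $\bar{\mathcal I}_n$ if and only if $\epsilon(u,v)\in\mathrm{Ann}_{s-r}(A)$ for all $\epsilon\in X$, all integers $r,s$ with $1\le r\le s\le n$, all $u\in\mathrm{Ann}_s(A)$ and all $v\in S_{r-1}(A)$.
   Context: A skew (left) brace is a set $A$ with two group structures $(A,\cdot)$, $(A,\circ)$ such that $a\circ(b\cdot c)=(a\circ b)\cdot a^{-1}\cdot(a\circ c)$ for all $a,b,c$, where $a^{-1}$ is the inverse in $(A,\cdot)$. The two identities coincide, denoted $1$. Put $\lambda_a(b)=a^{-1}\cdot(a\circ b)$, $a*b=\lambda_a(b)\cdot b^{-1}$, $[a,b]^{\cdot}=a\cdot b\cdot a^{-1}\cdot b^{-1}$. Annihilator series: $\mathrm{Ann}_0(A)=1$, $\mathrm{Ann}(A)=\mathrm{Ann}_1(A)=\{a: a*b=b*a=[a,b]^{\cdot}=1\ \forall b\in A\}$, $\mathrm{Ann}_n(A)/\mathrm{Ann}_{n-1}(A)=\mathrm{Ann}(A/\mathrm{Ann}_{n-1}(A))$; these are ideals of $A$ (subgroups of $(A,\cdot)$ stable under all $\lambda_a$ and normal in both groups). Commutator words: $M$ is the free monoid on the four symbols $X=\{\gamma,\bar\gamma,*,\bar *\}$, where $\gamma(a,b)=[a,b]^{\cdot}$, $\bar\gamma(a,b)=[b,a]^{\cdot}$, $*(a,b)=a*b$, $\bar *(a,b)=b*a$. For $m=\epsilon_1\cdots\epsilon_s\in M$ ($\epsilon_i\in X$), $\deg(m)=s$ and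 $m(a_1a_2\cdots a_{s+1})=\epsilon_1(a_1,\epsilon_2(a_2,\ldots,\epsilon_s(a_s,a_{s+1})\cdots))$. $S_0(A)=A$ and, for $r\ge1$, $S_r(A)=\{m(a_1\cdots a_{r+1}): m\in M,\ \deg(m)=r,\ a_i\in A\}$. $A_{(t)}$ is the subgroup of $(A,\cdot)$ generated by all values $m(a_1\cdots a_{\deg(m)+1})$ with $m\in M$, $\deg(m)\ge t$, $a_i\in A$. $\mathcal I_n$ is the class of skew braces $A$ such that for every $m\in M$ with $\deg(m)=n$ the map $\phi^A_m:(A/\mathrm{Ann}_n(A))^{n+1}\to A_{(n)}$, $(\mathrm{Ann}_n(A)a_1,\ldots,\mathrm{Ann}_n(A)a_{n+1})\mapsto m(a_1\cdots a_{n+1})$, is well defined. $\bar{\mathcal I}_n$ is the class of skew braces belonging to $\mathcal I_r$ for all $1\le r\le n$. *)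

theory Defs
  imports "HOL-Algebra.Coset" "HOL-Algebra.Generated_Groups"
begin

text \<open>
  A skew brace is a pair \<open>D\<close>, \<open>C\<close> of groups on the same carrier: \<open>D\<close> is \<open>(A, \<cdot>)\<close> and
  \<open>C\<close> is \<open>(A, \<circ>)\<close>. That \<open>\<one>\<^bsub>C\<^esub> = \<one>\<^bsub>D\<^esub>\<close> is a consequence and is not assumed.
\<close>

locale skew_brace = dot: group D + circ: group C
  for D :: "'a monoid" and C :: "'a monoid" +
  assumes carrier_eq: "carrier C = carrier D"
    and brace_distrib:
      "\<lbrakk> a \<in> carrier D; b \<in> carrier D; c \<in> carrier D \<rbrakk> \<Longrightarrow>
        a \<otimes>\<^bsub>C\<^esub> (b \<otimes>\<^bsub>D\<^esub> c) = (a \<otimes>\<^bsub>C\<^esub> b) \<otimes>\<^bsub>D\<^esub> inv\<^bsub>D\<^esub> a \<otimes>\<^bsub>D\<^esub> (a \<otimes>\<^bsub>C\<^esub> c)"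

definition brace_lambda :: "'a monoid \<Rightarrow> 'a monoid \<Rightarrow> 'a \<Rightarrow> 'a \<Rightarrow> 'a" where
  "brace_lambda D C a b = inv\<^bsub>D\<^esub> a \<otimes>\<^bsub>D\<^esub> (a \<otimes>\<^bsub>C\<^esub> b)"

definition brace_star :: "'a monoid \<Rightarrow> 'a monoid \<Rightarrow> 'a \<Rightarrow> 'a \<Rightarrow> 'a" where
  "brace_star D C a b = brace_lambda D C a b \<otimes>\<^bsub>D\<^esub> inv\<^bsub>D\<^esub> b"

definition dot_commutator :: "'a monoid \<Rightarrow> 'a \<Rightarrow> 'a \<Rightarrow> 'a" where
  "dot_commutator D a b = a \<otimes>\<^bsub>D\<^esub> b \<otimes>\<^bsub>D\<^esub> inv\<^bsub>D\<^esub> a \<otimes>\<^bsub>D\<^esub> inv\<^bsub>D\<^esub> b"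

definition Ann :: "'a monoid \<Rightarrow> 'a monoid \<Rightarrow> 'a set" where
  "Ann D C = {a \<in> carrier D. \<forall>b \<in> carrier D.
     brace_star D C a b = \<one>\<^bsub>D\<^esub> \<and> brace_star D C b a = \<one>\<^bsub>D\<^esub> \<and> dot_commutator D a b = \<one>\<^bsub>D\<^esub>}"

text \<open>
  The quotient of the skew brace \<open>D\<close>, \<open>C\<close> by an ideal \<open>N\<close> is the pair \<open>D Mod N\<close>, \<open>C Mod N\<close>:
  the cosets of an ideal in the two groups are the same sets. The step below takes the
  preimage of \<open>Ann (A / N)\<close>, where \<open>N\<close> is the previous term of the series.
\<close>

primrec Ann_series :: "'a monoid \<Rightarrow> 'a monoid \<Rightarrow> nat \<Rightarrow> 'a set" where
  "Ann_series D C 0 = {\<one>\<^bsub>D\<^esub>}"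
| "Ann_series D C (Suc n) =
     {a \<in> carrier D. Ann_series D C n #>\<^bsub>D\<^esub> a
        \<in> Ann (D Mod Ann_series D C n) (C Mod Ann_series D C n)}"

datatype comm_symbol = Gamma | Gamma_bar | Star | Star_bar

fun symbol_val :: "'a monoid \<Rightarrow> 'a monoid \<Rightarrow> comm_symbol \<Rightarrow> 'a \<Rightarrow> 'a \<Rightarrow> 'a" where
  "symbol_val D C Gamma a b = dot_commutator D a b"
| "symbol_val D C Gamma_bar a b = dot_commutator D b a"
| "symbol_val D C Star a b = brace_star D C a b"
| "symbol_val D C Star_bar a b = brace_star D C b a"

text \<open>
  The free monoid on the four symbols is \<open>comm_symbol list\<close>, with \<open>length\<close> as degree.
  \<open>word_val D C m as\<close> is meant for \<open>length as = length m + 1\<close>; the empty word has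
  value \<open>a\<close> at \<open>[a]\<close>.
\<close>

primrec word_val :: "'a monoid \<Rightarrow> 'a monoid \<Rightarrow> comm_symbol list \<Rightarrow> 'a list \<Rightarrow> 'a" where
  "word_val D C [] as = hd as"
| "word_val D C (e # m) as = symbol_val D C e (hd as) (word_val D C m (tl as))"

definition tuples :: "'a set \<Rightarrow> nat \<Rightarrow> 'a list set" where
  "tuples B k = {as. length as = k \<and> set as \<subseteq> B}"

definition word_values :: "'a monoid \<Rightarrow> 'a monoid \<Rightarrow> nat \<Rightarrow> 'a set" where
  "word_values D C r =
     (if r = 0 then carrier D
      else {word_val D C m as | m as. length m = r \<and> as \<in> tuples (carrier D) (r + 1)})"

definition word_subgroup :: "'a monoid \<Rightarrow> 'a monoid \<Rightarrow> nat \<Rightarrow> 'a set" where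
  "word_subgroup D C t =
     generate D {word_val D C m as | m as.
       length m \<ge> t \<and> as \<in> tuples (carrier D) (length m + 1)}"

text \<open>
  Well-definedness of \<open>\<phi>\<^sub>m : (A / Ann\<^sub>n(A))\<^sup>n\<^sup>+\<^sup>1 \<rightarrow> A\<^sub>(\<^sub>n\<^sub>)\<close>, where \<open>n = length m\<close>: some map
  between these sets satisfies the defining prescription on all tuples of representatives.
\<close>

definition phi_well_defined :: "'a monoid \<Rightarrow> 'a monoid \<Rightarrow> comm_symbol list \<Rightarrow> bool" where
  "phi_well_defined D C m \<longleftrightarrow>
     (let n = length m; N = Ann_series D C n in
      \<exists>\<phi> \<in> tuples (carrier (D Mod N)) (n + 1) \<rightarrow> word_subgroup D C n.
        \<forall>as \<in> tuples (carrier D) (n + 1). \<phi> (map (\<lambda>a. N #>\<^bsub>D\<^esub> a) as) = word_val D C m as)"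

definition class_I :: "nat \<Rightarrow> 'a monoid \<Rightarrow> 'a monoid \<Rightarrow> bool" where
  "class_I n D C \<longleftrightarrow> skew_brace D C \<and> (\<forall>m. length m = n \<longrightarrow> phi_well_defined D C m)"

definition class_I_bar :: "nat \<Rightarrow> 'a monoid \<Rightarrow> 'a monoid \<Rightarrow> bool" where
  "class_I_bar n D C \<longleftrightarrow> skew_brace D C \<and> (\<forall>r. 1 \<le> r \<and> r \<le> n \<longrightarrow> class_I r D C)"

end

theory Submission
  imports Defs
begin

text \<open>
  Everything rests on one description of the annihilator series: \<open>Ann\<^sub>k\<^sub>+\<^sub>1(A)\<close> consists of the
  \<open>u\<close> with \<open>\<epsilon>(u, b) \<in> Ann\<^sub>k(A)\<close> for all \<open>b\<close> and all symbols \<open>\<epsilon>\<close>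
  (\<open>Ann_series_Suc_iff\<close>). It needs that each \<open>Ann\<^sub>k(A)\<close> is an ideal, which follows by
  induction since \<open>Ann\<close> of a skew brace is an ideal and preimages of ideals are ideals.

  Suppose that \<open>A\<close> belongs to the class, \<open>u \<in> Ann\<^sub>s(A)\<close>, and \<open>v\<close> is the value of a word \<open>m'\<close> of
  degree \<open>r - 1\<close>. Iterating the description, \<open>\<epsilon>(u, v) \<in> Ann\<^sub>s\<^sub>-\<^sub>r(A)\<close> holds as soon as every word
  \<open>m\<close> of degree \<open>s - r\<close> vanishes when its last entry is \<open>\<epsilon>(u, v)\<close>. Such a value is a
  value of the word \<open>m\<epsilon>m'\<close> of degree \<open>s\<close> in which \<open>u\<close> is one of the entries. By
  well-definedness modulo \<open>Ann\<^sub>s(A)\<close>, \<open>u\<close> may be replaced by \<open>1\<close>, and then the word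
  collapses to \<open>1\<close>. This is \<open>symbol_val_in_Ann_series_if_class_I\<close>.

  Conversely, fix \<open>s\<close> and change the entries of a word of degree \<open>r \<le> s\<close> modulo \<open>Ann\<^sub>s(A)\<close>. By
  induction on the word, its value changes only modulo \<open>Ann\<^sub>s\<^sub>-\<^sub>r(A)\<close>; for \<open>r = s\<close> this is
  well-definedness. In \<open>\<epsilon>(a, v)\<close> with \<open>v\<close> the value of a word of degree \<open>r - 1\<close>, the
  hypothesis allows \<open>a\<close> to be changed modulo \<open>Ann\<^sub>s(A)\<close>, while the induction hypothesis says that
  \<open>v\<close> changes modulo \<open>Ann\<^sub>s\<^sub>-\<^sub>r\<^sub>+\<^sub>1(A)\<close>, all of whose elements satisfy \<open>\<epsilon>(w, a) \<in> Ann\<^sub>s\<^sub>-\<^sub>r(A)\<close>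
  by the description above. Both changes are instances of the same congruence lemma,
  \<open>symbol_val_cong\<close>, and the induction is \<open>word_val_cong_if_symbol_val_in_Ann_series\<close>.
\<close>

section \<open>Elementary identities in a skew brace\<close>

text \<open>
  The four symbols are closed under exchanging the arguments, so facts about the first argument
  of a symbol transfer to the second one.
\<close>

fun opposite :: "comm_symbol \<Rightarrow> comm_symbol" where
  "opposite Gamma = Gamma_bar"
| "opposite Gamma_bar = Gamma"
| "opposite Star = Star_bar"
| "opposite Star_bar = Star"

lemma symbol_val_opposite: "symbol_val D C (opposite \<epsilon>) a b = symbol_val D C \<epsilon> b a"
  by (cases \<epsilon>) simp_all

context skew_brace
begin

lemma circ_closed [simp]: "\<lbrakk>a \<in> carrier D; b \<in> carrier D\<rbrakk> \<Longrightarrow> a \<otimes>\<^bsub>C\<^esub> b \<in> carrier D"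
  using circ.m_closed carrier_eq by simp

lemma circ_inv_closed [simp]: "a \<in> carrier D \<Longrightarrow> inv\<^bsub>C\<^esub> a \<in> carrier D"
  using circ.inv_closed carrier_eq by simp

lemma lambda_closed [simp]:
  "\<lbrakk>a \<in> carrier D; b \<in> carrier D\<rbrakk> \<Longrightarrow> brace_lambda D C a b \<in> carrier D"
  by (simp add: brace_lambda_def)

lemma star_closed [simp]:
  "\<lbrakk>a \<in> carrier D; b \<in> carrier D\<rbrakk> \<Longrightarrow> brace_star D C a b \<in> carrier D"
  by (simp add: brace_star_def)

lemma commutator_closed [simp]:
  "\<lbrakk>a \<in> carrier D; b \<in> carrier D\<rbrakk> \<Longrightarrow> dot_commutator D a b \<in> carrier D"
  by (simp add: dot_commutator_def)

lemma symbol_val_closed [simp]: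
  "\<lbrakk>a \<in> carrier D; b \<in> carrier D\<rbrakk> \<Longrightarrow> symbol_val D C \<epsilon> a b \<in> carrier D"
  by (cases \<epsilon>) simp_all

lemma circ_eq_dot_lambda:
  "\<lbrakk>a \<in> carrier D; b \<in> carrier D\<rbrakk> \<Longrightarrow> a \<otimes>\<^bsub>C\<^esub> b = a \<otimes>\<^bsub>D\<^esub> brace_lambda D C a b"
  by (simp add: brace_lambda_def dot.m_assoc [symmetric])

lemma one_eq: "\<one>\<^bsub>C\<^esub> = \<one>\<^bsub>D\<^esub>"
proof -
  have c: "\<one>\<^bsub>C\<^esub> \<in> carrier D" and l: "\<And>x. x \<in> carrier D \<Longrightarrow> \<one>\<^bsub>C\<^esub> \<otimes>\<^bsub>C\<^esub> x = x"
    using circ.one_closed circ.l_one carrier_eq by auto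
  have "inv\<^bsub>D\<^esub> \<one>\<^bsub>C\<^esub> = \<one>\<^bsub>D\<^esub>"
    using brace_distrib [OF c dot.one_closed dot.one_closed] c by (simp add: l)
  with c show ?thesis
    by (metis dot.inv_inv dot.inv_one)
qed

lemma lambda_mult:
  assumes "a \<in> carrier D" "b \<in> carrier D" "c \<in> carrier D"
  shows "brace_lambda D C a (b \<otimes>\<^bsub>D\<^esub> c) = brace_lambda D C a b \<otimes>\<^bsub>D\<^esub> brace_lambda D C a c"
  using assms by (simp add: brace_lambda_def brace_distrib dot.m_assoc)

lemma lambda_circ:
  assumes "a \<in> carrier D" "b \<in> carrier D" "c \<in> carrier D"
  shows "brace_lambda D C (a \<otimes>\<^bsub>C\<^esub> b) c = brace_lambda D C a (brace_lambda D C b c)"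
proof -
  have "(a \<otimes>\<^bsub>C\<^esub> b) \<otimes>\<^bsub>D\<^esub> brace_lambda D C (a \<otimes>\<^bsub>C\<^esub> b) c = (a \<otimes>\<^bsub>C\<^esub> b) \<otimes>\<^bsub>C\<^esub> c"
    using assms by (simp add: circ_eq_dot_lambda)
  also have "\<dots> = a \<otimes>\<^bsub>C\<^esub> (b \<otimes>\<^bsub>D\<^esub> brace_lambda D C b c)"
    using assms carrier_eq by (simp add: circ.m_assoc circ_eq_dot_lambda [of b c, symmetric])
  also have "\<dots> = (a \<otimes>\<^bsub>C\<^esub> b) \<otimes>\<^bsub>D\<^esub> brace_lambda D C a (brace_lambda D C b c)"
    using assms by (simp add: brace_distrib brace_lambda_def [of D C a] dot.m_assoc)
  finally show ?thesis
    using assms by simp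
qed

lemma lambda_one_left [simp]: "b \<in> carrier D \<Longrightarrow> brace_lambda D C \<one>\<^bsub>D\<^esub> b = b"
  using circ.l_one carrier_eq by (simp add: brace_lambda_def one_eq)

lemma lambda_one_right [simp]: "a \<in> carrier D \<Longrightarrow> brace_lambda D C a \<one>\<^bsub>D\<^esub> = \<one>\<^bsub>D\<^esub>"
  by (metis brace_lambda_def carrier_eq circ.r_one dot.l_inv one_eq)

lemma lambda_inv:
  assumes "a \<in> carrier D" "b \<in> carrier D"
  shows "brace_lambda D C a (inv\<^bsub>D\<^esub> b) = inv\<^bsub>D\<^esub> brace_lambda D C a b"
  using lambda_mult [of a "inv\<^bsub>D\<^esub> b" b] assms by (metis dot.inv_closed dot.inv_equality
    dot.l_inv lambda_closed lambda_one_right)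

lemma lambda_circ_inv [simp]:
  assumes "a \<in> carrier D" "b \<in> carrier D"
  shows "brace_lambda D C a (brace_lambda D C (inv\<^bsub>C\<^esub> a) b) = b"
proof -
  have "a \<otimes>\<^bsub>C\<^esub> inv\<^bsub>C\<^esub> a = \<one>\<^bsub>D\<^esub>"
    using assms circ.r_inv carrier_eq one_eq by simp
  then show ?thesis
    using assms by (metis circ_inv_closed lambda_circ lambda_one_left)
qed

lemma star_eq_one_iff:
  "\<lbrakk>a \<in> carrier D; b \<in> carrier D\<rbrakk> \<Longrightarrow>
    brace_star D C a b = \<one>\<^bsub>D\<^esub> \<longleftrightarrow> brace_lambda D C a b = b"
  by (metis brace_star_def dot.inv_closed dot.inv_equality dot.inv_inv dot.r_inv lambda_closed)

lemma commutator_eq_one_iff: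
  assumes "a \<in> carrier D" "b \<in> carrier D"
  shows "dot_commutator D a b = \<one>\<^bsub>D\<^esub> \<longleftrightarrow> a \<otimes>\<^bsub>D\<^esub> b = b \<otimes>\<^bsub>D\<^esub> a"
proof -
  have "dot_commutator D a b = (a \<otimes>\<^bsub>D\<^esub> b) \<otimes>\<^bsub>D\<^esub> inv\<^bsub>D\<^esub> (b \<otimes>\<^bsub>D\<^esub> a)"
    using assms by (simp add: dot_commutator_def dot.inv_mult_group dot.m_assoc)
  then show ?thesis
    using assms by (metis dot.inv_equality dot.inv_inv dot.inv_closed dot.m_closed dot.r_inv)
qed

lemma symbol_val_one_left [simp]: "a \<in> carrier D \<Longrightarrow> symbol_val D C \<epsilon> \<one>\<^bsub>D\<^esub> a = \<one>\<^bsub>D\<^esub>"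
  by (cases \<epsilon>) (simp_all add: star_eq_one_iff commutator_eq_one_iff)

lemma symbol_val_one_right [simp]: "a \<in> carrier D \<Longrightarrow> symbol_val D C \<epsilon> a \<one>\<^bsub>D\<^esub> = \<one>\<^bsub>D\<^esub>"
  by (cases \<epsilon>) (simp_all add: star_eq_one_iff commutator_eq_one_iff)


text \<open>
  If every symbol is trivial on \<open>u\<close> and \<open>b\<close>, then \<open>u\<close> and \<open>b\<close> commute in \<open>(A, \<cdot>)\<close> and
  \<open>\<lambda>\<^sub>b(u) = u\<close>. The factor \<open>u\<close> is put to the right of \<open>a\<close>: in \<open>a u b u\<inverse> a\<inverse> b\<inverse>\<close> it then meets
  \<open>b\<close> and cancels, whereas on the left it would have to commute with \<open>[a, b]\<close> as well.
\<close>

lemma dot_mult_kills: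
  assumes "a \<in> carrier D" "b \<in> carrier D" "u \<in> carrier D"
    and kill: "\<And>\<epsilon>. symbol_val D C \<epsilon> u b = \<one>\<^bsub>D\<^esub>"
  shows "dot_commutator D (a \<otimes>\<^bsub>D\<^esub> u) b = dot_commutator D a b"
    and "dot_commutator D b (a \<otimes>\<^bsub>D\<^esub> u) = dot_commutator D b a"
    and "brace_star D C b (a \<otimes>\<^bsub>D\<^esub> u) = brace_star D C b a"
proof -
  have ub: "u \<otimes>\<^bsub>D\<^esub> b = b \<otimes>\<^bsub>D\<^esub> u"
    using kill [of Gamma] assms by (simp add: commutator_eq_one_iff)
  have l: "brace_lambda D C b u = u"
    using kill [of Star_bar] assms by (simp add: star_eq_one_iff)
  have e: "a \<otimes>\<^bsub>D\<^esub> u \<otimes>\<^bsub>D\<^esub> b = a \<otimes>\<^bsub>D\<^esub> b \<otimes>\<^bsub>D\<^esub> u"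
    using assms ub by (simp add: dot.m_assoc)
  have c: "u \<otimes>\<^bsub>D\<^esub> (inv\<^bsub>D\<^esub> u \<otimes>\<^bsub>D\<^esub> x) = x" if "x \<in> carrier D" for x
    using assms that by (simp add: dot.m_assoc [symmetric])
  show 1: "dot_commutator D (a \<otimes>\<^bsub>D\<^esub> u) b = dot_commutator D a b"
    using assms by (simp add: dot_commutator_def e) (simp add: dot.m_assoc dot.inv_mult_group c)
  have inv: "dot_commutator D b x = inv\<^bsub>D\<^esub> dot_commutator D x b" if "x \<in> carrier D" for x
    using assms that by (simp add: dot_commutator_def dot.inv_mult_group dot.m_assoc)
  show "dot_commutator D b (a \<otimes>\<^bsub>D\<^esub> u) = dot_commutator D b a"
    using assms 1 by (simp add: inv)
  show "brace_star D C b (a \<otimes>\<^bsub>D\<^esub> u) = brace_star D C b a"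
    using assms by (simp add: brace_star_def lambda_mult l dot.inv_mult_group dot.m_assoc c)
qed

text \<open>
  Only the star with the changed entry on the left requires the product \<open>a \<circ> u\<close>, because
  \<open>\<lambda>\<close> is multiplicative in its index with respect to \<open>\<circ>\<close>.
\<close>

lemma circ_mult_kills:
  assumes "a \<in> carrier D" "b \<in> carrier D" "u \<in> carrier D"
    and "brace_star D C u b = \<one>\<^bsub>D\<^esub>"
  shows "brace_star D C (a \<otimes>\<^bsub>C\<^esub> u) b = brace_star D C a b"
  using assms by (simp add: star_eq_one_iff) (simp add: brace_star_def lambda_circ)

end

section \<open>Ideals and quotients\<close>

definition brace_ideal :: "'a monoid \<Rightarrow> 'a monoid \<Rightarrow> 'a set \<Rightarrow> bool" where
  "brace_ideal D C N \<longleftrightarrow> N \<lhd> D \<and> N \<lhd> C \<and>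
     (\<forall>a \<in> carrier D. \<forall>x \<in> N. brace_lambda D C a x \<in> N)"

context skew_brace
begin

lemma trivial_ideal: "brace_ideal D C {\<one>\<^bsub>D\<^esub>}"
  using dot.one_is_normal circ.one_is_normal by (simp add: brace_ideal_def one_eq)

lemma Ann_iff:
  "a \<in> Ann D C \<longleftrightarrow> a \<in> carrier D \<and> (\<forall>b \<in> carrier D.
     brace_lambda D C a b = b \<and> brace_lambda D C b a = a \<and> a \<otimes>\<^bsub>D\<^esub> b = b \<otimes>\<^bsub>D\<^esub> a)"
  by (auto simp: Ann_def star_eq_one_iff commutator_eq_one_iff)

lemma Ann_iff_symbols:
  "a \<in> Ann D C \<longleftrightarrow> a \<in> carrier D \<and>
     (\<forall>b \<in> carrier D. \<forall>\<epsilon>. symbol_val D C \<epsilon> a b = \<one>\<^bsub>D\<^esub>)"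
proof
  assume "a \<in> Ann D C"
  moreover from this have "symbol_val D C \<epsilon> a b = \<one>\<^bsub>D\<^esub>" if "b \<in> carrier D" for b \<epsilon>
    using that by (cases \<epsilon>) (auto simp: Ann_iff star_eq_one_iff commutator_eq_one_iff)
  ultimately show "a \<in> carrier D \<and> (\<forall>b \<in> carrier D. \<forall>\<epsilon>. symbol_val D C \<epsilon> a b = \<one>\<^bsub>D\<^esub>)"
    by (simp add: Ann_iff)
next
  assume *: "a \<in> carrier D \<and> (\<forall>b \<in> carrier D. \<forall>\<epsilon>. symbol_val D C \<epsilon> a b = \<one>\<^bsub>D\<^esub>)"
  then have "symbol_val D C Star a b = \<one>\<^bsub>D\<^esub>" "symbol_val D C Star_bar a b = \<one>\<^bsub>D\<^esub>"
      "symbol_val D C Gamma a b = \<one>\<^bsub>D\<^esub>" if "b \<in> carrier D" for b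
    using that by blast+
  with * show "a \<in> Ann D C"
    by (simp add: Ann_def)
qed

text \<open>
  On \<open>Ann(A)\<close> the two products with an arbitrary element coincide, so its elements are central in
  both groups and their two inverses agree.
\<close>

lemma Ann_ideal: "brace_ideal D C (Ann D C)"
proof -
  have circ_dot: "a \<otimes>\<^bsub>C\<^esub> b = a \<otimes>\<^bsub>D\<^esub> b \<and> b \<otimes>\<^bsub>C\<^esub> a = a \<otimes>\<^bsub>D\<^esub> b"
    if "a \<in> Ann D C" "b \<in> carrier D" for a b
    using that by (simp add: Ann_iff circ_eq_dot_lambda)
  have car: "Ann D C \<subseteq> carrier D"
    by (auto simp: Ann_def)
  have one: "\<one>\<^bsub>D\<^esub> \<in> Ann D C"
    by (simp add: Ann_iff)
  have mult: "a \<otimes>\<^bsub>D\<^esub> b \<in> Ann D C" if a: "a \<in> Ann D C" and b: "b \<in> Ann D C" for a b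
  proof -
    have c: "a \<in> carrier D" "b \<in> carrier D"
      using a b car by auto
    have "brace_lambda D C (a \<otimes>\<^bsub>D\<^esub> b) x = x" if "x \<in> carrier D" for x
      using lambda_circ [OF c that] circ_dot [OF a c(2)] a b that unfolding Ann_iff by metis
    moreover have "a \<otimes>\<^bsub>D\<^esub> b \<otimes>\<^bsub>D\<^esub> x = x \<otimes>\<^bsub>D\<^esub> (a \<otimes>\<^bsub>D\<^esub> b)" if x: "x \<in> carrier D" for x
      using a b x c unfolding Ann_iff by (metis dot.m_assoc)
    ultimately show ?thesis
      using a b c unfolding Ann_iff by (metis dot.m_closed lambda_mult)
  qed
  have inv: "inv\<^bsub>D\<^esub> a \<in> Ann D C" and inv_eq: "inv\<^bsub>C\<^esub> a = inv\<^bsub>D\<^esub> a" if a: "a \<in> Ann D C" for a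
  proof -
    have c: "a \<in> carrier D"
      using a car by auto
    have "inv\<^bsub>D\<^esub> a \<otimes>\<^bsub>C\<^esub> a = \<one>\<^bsub>C\<^esub>"
      using circ_dot [OF a, of "inv\<^bsub>D\<^esub> a"] c one_eq by simp
    then show eq: "inv\<^bsub>C\<^esub> a = inv\<^bsub>D\<^esub> a"
      using c carrier_eq by (simp add: circ.inv_equality)
    have "brace_lambda D C (inv\<^bsub>D\<^esub> a) x = x" if "x \<in> carrier D" for x
      using lambda_circ_inv [OF c that] a c that eq unfolding Ann_iff
      by (metis dot.inv_closed lambda_closed)
    moreover have "inv\<^bsub>D\<^esub> a \<otimes>\<^bsub>D\<^esub> x = x \<otimes>\<^bsub>D\<^esub> inv\<^bsub>D\<^esub> a" if x: "x \<in> carrier D" for x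
      using a x c unfolding Ann_iff
      by (metis dot.inv_closed dot.inv_inv dot.inv_mult_group)
    ultimately show "inv\<^bsub>D\<^esub> a \<in> Ann D C"
      using a c unfolding Ann_iff by (metis dot.inv_closed lambda_inv)
  qed
  have "subgroup (Ann D C) D"
    using car one mult inv by (intro dot.subgroupI) auto
  moreover have "x \<otimes>\<^bsub>D\<^esub> a \<otimes>\<^bsub>D\<^esub> inv\<^bsub>D\<^esub> x \<in> Ann D C" if "x \<in> carrier D" and a: "a \<in> Ann D C" for x a
  proof -
    have "x \<otimes>\<^bsub>D\<^esub> a \<otimes>\<^bsub>D\<^esub> inv\<^bsub>D\<^esub> x = a"
      using that car by (metis Ann_iff dot.m_assoc dot.r_inv dot.r_one dot.inv_closed)
    then show ?thesis using a by simp
  qed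
  moreover have "subgroup (Ann D C) C"
    using car one mult inv circ_dot inv_eq by (intro circ.subgroupI) (auto simp: carrier_eq)
  moreover have "x \<otimes>\<^bsub>C\<^esub> a \<otimes>\<^bsub>C\<^esub> inv\<^bsub>C\<^esub> x \<in> Ann D C" if "x \<in> carrier C" and a: "a \<in> Ann D C" for x a
  proof -
    have "x \<otimes>\<^bsub>C\<^esub> a = a \<otimes>\<^bsub>C\<^esub> x" "a \<in> carrier C"
      using circ_dot [OF a, of x] that(1) car a carrier_eq by auto
    then have "x \<otimes>\<^bsub>C\<^esub> a \<otimes>\<^bsub>C\<^esub> inv\<^bsub>C\<^esub> x = a"
      using that(1) by (simp add: circ.m_assoc)
    then show ?thesis using a by simp
  qed
  ultimately show ?thesis
    unfolding brace_ideal_def by (auto intro!: dot.normal_invI circ.normal_invI simp: Ann_iff)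
qed

end

locale brace_hom = A: skew_brace D C + B: skew_brace D' C'
  for D C :: "'a monoid" and D' C' :: "'b monoid" +
  fixes h :: "'a \<Rightarrow> 'b"
  assumes hom_dot: "h \<in> hom D D'" and hom_circ: "h \<in> hom C C'"
begin

sublocale dot: group_hom D D' h
  by unfold_locales (rule hom_dot)

sublocale circ: group_hom C C' h
  by unfold_locales (rule hom_circ)

lemma hom_circ_mult: "\<lbrakk>a \<in> carrier D; b \<in> carrier D\<rbrakk> \<Longrightarrow> h (a \<otimes>\<^bsub>C\<^esub> b) = h a \<otimes>\<^bsub>C'\<^esub> h b"
  using circ.hom_mult A.carrier_eq by simp

lemma hom_lambda:
  "\<lbrakk>a \<in> carrier D; b \<in> carrier D\<rbrakk> \<Longrightarrow> h (brace_lambda D C a b) = brace_lambda D' C' (h a) (h b)"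
  by (simp add: brace_lambda_def hom_circ_mult)

lemma hom_star:
  "\<lbrakk>a \<in> carrier D; b \<in> carrier D\<rbrakk> \<Longrightarrow> h (brace_star D C a b) = brace_star D' C' (h a) (h b)"
  by (simp add: brace_star_def hom_lambda)

lemma hom_symbol_val:
  "\<lbrakk>a \<in> carrier D; b \<in> carrier D\<rbrakk> \<Longrightarrow>
    h (symbol_val D C \<epsilon> a b) = symbol_val D' C' \<epsilon> (h a) (h b)"
  by (cases \<epsilon>) (simp_all add: hom_star dot_commutator_def)

lemma ideal_vimage:
  assumes "brace_ideal D' C' J"
  shows "brace_ideal D C {a \<in> carrier D. h a \<in> J}"
proof -
  have nD: "J \<lhd> D'" and nC: "J \<lhd> C'"
    and l: "\<And>a x. \<lbrakk>a \<in> carrier D'; x \<in> J\<rbrakk> \<Longrightarrow> brace_lambda D' C' a x \<in> J"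
    using assms by (auto simp: brace_ideal_def)
  interpret JD: normal J D' by (rule nD)
  interpret JC: normal J C' by (rule nC)
  have "{a \<in> carrier D. h a \<in> J} \<lhd> D"
    by (intro A.dot.normal_invI A.dot.subgroupI)
      (auto intro: JD.inv_op_closed2 exI [of _ "\<one>\<^bsub>D\<^esub>"])
  moreover have "{a \<in> carrier C. h a \<in> J} \<lhd> C"
    by (intro A.circ.normal_invI A.circ.subgroupI)
      (auto intro: JC.inv_op_closed2 exI [of _ "\<one>\<^bsub>C\<^esub>"])
  ultimately show ?thesis
    using l A.carrier_eq by (auto simp: brace_ideal_def hom_lambda)
qed

end

context skew_brace
begin

text \<open>
  Left cosets agree because \<open>a \<circ> x = a \<cdot> \<lambda>\<^sub>a(x)\<close> and \<open>\<lambda>\<^sub>a\<close> permutes an ideal; normality in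
  both groups transports this to right cosets. It makes the coset map of \<open>(A, \<cdot>)\<close> a homomorphism
  for both structures.
\<close>

lemma ideal_cosets_eq:
  assumes N: "brace_ideal D C N" and a: "a \<in> carrier D"
  shows "N #>\<^bsub>C\<^esub> a = N #>\<^bsub>D\<^esub> a"
proof -
  have nD: "N \<lhd> D" and nC: "N \<lhd> C"
    and l: "\<And>a x. \<lbrakk>a \<in> carrier D; x \<in> N\<rbrakk> \<Longrightarrow> brace_lambda D C a x \<in> N"
    using N by (auto simp: brace_ideal_def)
  have sub: "x \<in> carrier D" if "x \<in> N" for x
    using nD that by (meson normal_imp_subgroup subgroup.mem_carrier)
  have "a <#\<^bsub>C\<^esub> N \<subseteq> a <#\<^bsub>D\<^esub> N"
    using a l sub by (auto simp: l_coset_def circ_eq_dot_lambda)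
  moreover have "a <#\<^bsub>D\<^esub> N \<subseteq> a <#\<^bsub>C\<^esub> N"
  proof
    fix y assume "y \<in> a <#\<^bsub>D\<^esub> N"
    then obtain x where x: "x \<in> N" "y = a \<otimes>\<^bsub>D\<^esub> x"
      by (auto simp: l_coset_def)
    then have "y = a \<otimes>\<^bsub>C\<^esub> brace_lambda D C (inv\<^bsub>C\<^esub> a) x"
      using a sub by (simp add: circ_eq_dot_lambda)
    moreover have "brace_lambda D C (inv\<^bsub>C\<^esub> a) x \<in> N"
      using x a l by simp
    ultimately show "y \<in> a <#\<^bsub>C\<^esub> N"
      by (auto simp: l_coset_def)
  qed
  ultimately show ?thesis
    using normal.coset_eq [OF nD] normal.coset_eq [OF nC] a carrier_eq by auto
qed

lemma quotient_hom:
  assumes N: "brace_ideal D C N"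
  shows "brace_hom D C (D Mod N) (C Mod N) (\<lambda>a. N #>\<^bsub>D\<^esub> a)"
proof -
  have nD: "N \<lhd> D" and nC: "N \<lhd> C"
    using N by (auto simp: brace_ideal_def)
  interpret ND: normal N D by (rule nD)
  interpret NC: normal N C by (rule nC)
  let ?h = "\<lambda>a. N #>\<^bsub>D\<^esub> a"
  have hD: "?h \<in> hom D (D Mod N)"
    by (rule ND.r_coset_hom_Mod)
  have "?h a = N #>\<^bsub>C\<^esub> a" if "a \<in> carrier C" for a
    using ideal_cosets_eq [OF N] that carrier_eq by simp
  then have hC: "?h \<in> hom C (C Mod N)"
    using NC.r_coset_hom_Mod by (simp add: hom_def Pi_iff)
  have gD: "group (D Mod N)" and gC: "group (C Mod N)"
    using ND.factorgroup_is_group NC.factorgroup_is_group by auto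
  interpret hD: group_hom D "D Mod N" ?h
    using hD gD by (simp add: group_hom_def group_hom_axioms_def dot.group_axioms)
  have car: "carrier (C Mod N) = carrier (D Mod N)"
    using ideal_cosets_eq [OF N] by (simp add: carrier_FactGroup carrier_eq)
  have circ: "?h (a \<otimes>\<^bsub>C\<^esub> b) = ?h a \<otimes>\<^bsub>C Mod N\<^esub> ?h b" if "a \<in> carrier D" "b \<in> carrier D" for a b
    using hom_mult [OF hC, of a b] that by (simp add: carrier_eq)
  have dist: "X \<otimes>\<^bsub>C Mod N\<^esub> (Y \<otimes>\<^bsub>D Mod N\<^esub> Z)
      = (X \<otimes>\<^bsub>C Mod N\<^esub> Y) \<otimes>\<^bsub>D Mod N\<^esub> inv\<^bsub>D Mod N\<^esub> X \<otimes>\<^bsub>D Mod N\<^esub> (X \<otimes>\<^bsub>C Mod N\<^esub> Z)"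
    if XYZ: "X \<in> carrier (D Mod N)" "Y \<in> carrier (D Mod N)" "Z \<in> carrier (D Mod N)" for X Y Z
  proof -
    obtain a b c where abc: "a \<in> carrier D" "b \<in> carrier D" "c \<in> carrier D"
      and eq: "X = ?h a" "Y = ?h b" "Z = ?h c"
      using XYZ unfolding carrier_FactGroup by blast
    have "?h (a \<otimes>\<^bsub>C\<^esub> (b \<otimes>\<^bsub>D\<^esub> c)) = ?h ((a \<otimes>\<^bsub>C\<^esub> b) \<otimes>\<^bsub>D\<^esub> inv\<^bsub>D\<^esub> a \<otimes>\<^bsub>D\<^esub> (a \<otimes>\<^bsub>C\<^esub> c))"
      using abc by (simp add: brace_distrib)
    then show ?thesis
      unfolding eq using abc by (simp only: circ hD.hom_mult hD.hom_inv dot.m_closed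
        dot.inv_closed circ_closed)
  qed
  have "skew_brace (D Mod N) (C Mod N)"
    using gD gC car dist by (simp only: skew_brace_def skew_brace_axioms_def) blast
  then show ?thesis
    using hD hC skew_brace_axioms by (simp add: brace_hom_def brace_hom_axioms_def)
qed

lemma coset_eq_self_iff:
  assumes "brace_ideal D C N" "a \<in> carrier D"
  shows "N #>\<^bsub>D\<^esub> a = N \<longleftrightarrow> a \<in> N"
  using assms dot.coset_join1 dot.coset_join2 normal_imp_subgroup
  unfolding brace_ideal_def by metis

text \<open>
  The coset of \<open>a\<close> modulo \<open>N\<close> can be written both as \<open>a \<cdot> N\<close> and as \<open>a \<circ> N\<close>. Thus \<open>a'\<close> may be
  expressed through either product, whichever suits the symbol, and the computation takes place in
  the quotient by \<open>K\<close>, where the elements of \<open>N\<close> have become trivial against \<open>b\<close>.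
\<close>

lemma symbol_val_cong:
  assumes N: "brace_ideal D C N" and K: "brace_ideal D C K"
    and a: "a \<in> carrier D" "a' \<in> carrier D" "N #>\<^bsub>D\<^esub> a = N #>\<^bsub>D\<^esub> a'" and b: "b \<in> carrier D"
    and kill: "\<And>u \<epsilon>. u \<in> N \<Longrightarrow> symbol_val D C \<epsilon> u b \<in> K"
  shows "K #>\<^bsub>D\<^esub> symbol_val D C \<epsilon> a b = K #>\<^bsub>D\<^esub> symbol_val D C \<epsilon> a' b"
proof -
  interpret q: brace_hom D C "D Mod K" "C Mod K" "\<lambda>a. K #>\<^bsub>D\<^esub> a"
    by (rule quotient_hom [OF K])
  have nD: "N \<lhd> D" and nC: "N \<lhd> C"
    using N by (auto simp: brace_ideal_def)
  have sub: "x \<in> carrier D" if "x \<in> N" for x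
    using nD that by (meson normal_imp_subgroup subgroup.mem_carrier)
  have qkill: "symbol_val (D Mod K) (C Mod K) \<epsilon> (K #>\<^bsub>D\<^esub> u) (K #>\<^bsub>D\<^esub> b) = \<one>\<^bsub>D Mod K\<^esub>"
    if "u \<in> N" for u \<epsilon>
    using kill [OF that] coset_eq_self_iff [OF K] b sub [OF that] q.hom_symbol_val
    by (metis one_FactGroup symbol_val_closed)
  have mem: "a' \<in> N #>\<^bsub>D\<^esub> a"
    using a nD dot.rcos_self normal_imp_subgroup by metis
  then obtain u where u: "u \<in> N" "a' = a \<otimes>\<^bsub>D\<^esub> u"
    using bspec [OF normal.coset_eq [OF nD] a(1)] by (auto simp: l_coset_def)
  have "a' \<in> a <#\<^bsub>C\<^esub> N"
    using mem ideal_cosets_eq [OF N a(1)] bspec [OF normal.coset_eq [OF nC], of a] a(1) carrier_eq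
    by simp
  then obtain u' where u': "u' \<in> N" "a' = a \<otimes>\<^bsub>C\<^esub> u'"
    by (auto simp: l_coset_def)
  note [simp del] = mult_FactGroup one_FactGroup
  note c = q.dot.hom_closed [OF a(1)] q.dot.hom_closed [OF b]
  have cu: "K #>\<^bsub>D\<^esub> u \<in> carrier (D Mod K)" "K #>\<^bsub>D\<^esub> u' \<in> carrier (D Mod K)"
    using sub u u' by auto
  show ?thesis
  proof (cases "\<epsilon> = Star")
    case True
    then show ?thesis
      using q.B.circ_mult_kills [OF c cu(2)] qkill [OF u'(1), of Star] a b sub [OF u'(1)]
      by (simp add: u'(2) q.hom_star q.hom_circ_mult)
  next
    case False
    then show ?thesis
      using q.B.dot_mult_kills [OF c cu(1) qkill [OF u(1)]] a b sub [OF u(1)]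
      by (cases \<epsilon>) (simp_all add: u(2) q.hom_symbol_val [of _ _ Gamma, simplified]
         q.hom_symbol_val [of _ _ Gamma_bar, simplified] q.hom_star)
  qed
qed

end


section \<open>The annihilator series\<close>

context skew_brace
begin

lemma Ann_series_ideal: "brace_ideal D C (Ann_series D C k)"
proof (induction k)
  case 0
  show ?case
    by (simp add: trivial_ideal)
next
  case (Suc k)
  then interpret q: brace_hom D C "D Mod Ann_series D C k" "C Mod Ann_series D C k"
      "\<lambda>a. Ann_series D C k #>\<^bsub>D\<^esub> a"
    by (rule quotient_hom)
  show ?case
    using q.ideal_vimage [OF q.B.Ann_ideal] by simp
qed

lemma Ann_series_subgroup: "subgroup (Ann_series D C k) D"
  using Ann_series_ideal unfolding brace_ideal_def by (blast intro: normal_imp_subgroup)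

lemma Ann_series_closed: "u \<in> Ann_series D C k \<Longrightarrow> u \<in> carrier D"
  using Ann_series_subgroup by (rule subgroup.mem_carrier)

lemma Ann_series_Suc_iff:
  "a \<in> Ann_series D C (Suc k) \<longleftrightarrow> a \<in> carrier D \<and>
     (\<forall>b \<in> carrier D. \<forall>\<epsilon>. symbol_val D C \<epsilon> a b \<in> Ann_series D C k)"
proof -
  let ?N = "Ann_series D C k"
  interpret q: brace_hom D C "D Mod ?N" "C Mod ?N" "\<lambda>a. ?N #>\<^bsub>D\<^esub> a"
    by (rule quotient_hom [OF Ann_series_ideal])
  have kill: "symbol_val (D Mod ?N) (C Mod ?N) \<epsilon> (?N #>\<^bsub>D\<^esub> a) (?N #>\<^bsub>D\<^esub> b) = \<one>\<^bsub>D Mod ?N\<^esub>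
      \<longleftrightarrow> symbol_val D C \<epsilon> a b \<in> ?N"
    if "a \<in> carrier D" "b \<in> carrier D" for b \<epsilon>
    using that q.hom_symbol_val coset_eq_self_iff [OF Ann_series_ideal]
    by (metis one_FactGroup symbol_val_closed)
  show ?thesis
    using q.B.Ann_iff_symbols [of "?N #>\<^bsub>D\<^esub> a"] kill
    by (auto simp: carrier_FactGroup simp del: one_FactGroup)
qed

section \<open>Words\<close>

lemma word_val_closed:
  "as \<in> tuples (carrier D) (length m + 1) \<Longrightarrow> word_val D C m as \<in> carrier D"
proof (induction m arbitrary: as)
  case Nil
  then show ?case
    by (cases as) (auto simp: tuples_def)
next
  case (Cons e m)
  from Cons.prems obtain a as' where "as = a # as'"
    by (cases as) (auto simp: tuples_def)
  with Cons show ?case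
    by (auto simp: tuples_def)
qed

lemma word_val_append:
  "length as = length m \<Longrightarrow>
    word_val D C (m @ m') (as @ bs) = word_val D C m (as @ [word_val D C m' bs])"
  by (induction as m rule: list_induct2) simp_all

lemma word_val_one:
  "\<lbrakk>length as = length m; set as \<subseteq> carrier D\<rbrakk> \<Longrightarrow> word_val D C m (as @ [\<one>\<^bsub>D\<^esub>]) = \<one>\<^bsub>D\<^esub>"
  by (induction as m rule: list_induct2) simp_all

lemma word_values_eq:
  "word_values D C r = {word_val D C m as | m as. length m = r \<and> as \<in> tuples (carrier D) (r + 1)}"
proof (cases r)
  case 0
  have "x = word_val D C [] [x] \<and> [x] \<in> tuples (carrier D) 1" if "x \<in> carrier D" for x
    using that by (simp add: tuples_def)
  moreover have "hd as \<in> carrier D" if "as \<in> tuples (carrier D) 1" for as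
    using that by (cases as) (auto simp: tuples_def)
  ultimately show ?thesis
    using 0 by (fastforce simp: word_values_def)
qed (simp add: word_values_def)

text \<open>
  The \<open>k\<close>-fold iteration of the description of one step of the series. The innermost symbol of the
  word has \<open>x\<close> as its second argument, whence the opposite symbol.
\<close>

lemma Ann_series_if_words_vanish:
  assumes "x \<in> carrier D"
    and "\<And>m as. \<lbrakk>length m = k; as \<in> tuples (carrier D) k\<rbrakk> \<Longrightarrow> word_val D C m (as @ [x]) = \<one>\<^bsub>D\<^esub>"
  shows "x \<in> Ann_series D C k"
  using assms
proof (induction k arbitrary: x)
  case 0
  then show ?case
    using "0.prems"(2) [of "[]" "[]"] by (simp add: tuples_def)
next
  case (Suc k)
  have "symbol_val D C \<epsilon> x b \<in> Ann_series D C k" if b: "b \<in> carrier D" for b \<epsilon>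
  proof (rule Suc.IH)
    fix m :: "comm_symbol list" and as
    assume m: "length m = k" "as \<in> tuples (carrier D) k"
    have "word_val D C (m @ [opposite \<epsilon>]) ((as @ [b]) @ [x]) = \<one>\<^bsub>D\<^esub>"
      using m b by (intro Suc.prems(2)) (auto simp: tuples_def)
    then show "word_val D C m (as @ [symbol_val D C \<epsilon> x b]) = \<one>\<^bsub>D\<^esub>"
      using word_val_append [of as m "[opposite \<epsilon>]" "[b, x]"] m
      by (simp add: tuples_def symbol_val_opposite)
  qed (use b Suc.prems in simp)
  then show ?case
    using Suc.prems(1) by (simp add: Ann_series_Suc_iff del: Ann_series.simps)
qed

section \<open>Well-definedness on cosets\<close>

text \<open>
  A map with the prescribed values exists as soon as these do not depend on representatives:
  evaluate the word at chosen representatives. Word values lie in the required subgroup because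
  they are among its generators.
\<close>

lemma phi_well_defined_iff:
  "phi_well_defined D C m \<longleftrightarrow>
    (\<forall>as \<in> tuples (carrier D) (length m + 1). \<forall>bs \<in> tuples (carrier D) (length m + 1).
      map (\<lambda>a. Ann_series D C (length m) #>\<^bsub>D\<^esub> a) as = map (\<lambda>a. Ann_series D C (length m) #>\<^bsub>D\<^esub> a) bs
      \<longrightarrow> word_val D C m as = word_val D C m bs)" (is "?L \<longleftrightarrow> ?R")
proof
  assume ?L
  then show ?R
    unfolding phi_well_defined_def Let_def by metis
next
  assume R: ?R
  let ?N = "Ann_series D C (length m)"
  let ?h = "map (\<lambda>a. ?N #>\<^bsub>D\<^esub> a)"
  let ?T = "tuples (carrier D) (length m + 1)"
  define rep where "rep cs = (SOME as. as \<in> ?T \<and> ?h as = cs)" for cs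
  have rep: "rep cs \<in> ?T \<and> ?h (rep cs) = cs" if "as \<in> ?T" "?h as = cs" for as cs
    unfolding rep_def by (rule someI [of "\<lambda>as. as \<in> ?T \<and> ?h as = cs", OF conjI [OF that]])
  have surj: "\<exists>as \<in> ?T. ?h as = cs" if cs: "cs \<in> tuples (carrier (D Mod ?N)) (length m + 1)" for cs
  proof -
    have "cs \<in> lists ((\<lambda>a. ?N #>\<^bsub>D\<^esub> a) ` carrier D)"
      using cs by (auto simp: tuples_def carrier_FactGroup)
    then obtain as where "as \<in> lists (carrier D)" "cs = ?h as"
      unfolding lists_image by blast
    then show ?thesis
      using cs by (intro bexI [of _ as]) (auto simp: tuples_def)
  qed
  have "(\<lambda>cs. word_val D C m (rep cs)) \<in> tuples (carrier (D Mod ?N)) (length m + 1)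
      \<rightarrow> word_subgroup D C (length m)"
  proof
    fix cs assume "cs \<in> tuples (carrier (D Mod ?N)) (length m + 1)"
    then have "rep cs \<in> ?T"
      using surj rep by blast
    then show "word_val D C m (rep cs) \<in> word_subgroup D C (length m)"
      unfolding word_subgroup_def by (intro generate.incl) blast
  qed
  moreover have "word_val D C m (rep (?h as)) = word_val D C m as" if "as \<in> ?T" for as
    using R rep [OF that refl] that by blast
  ultimately show ?L
    unfolding phi_well_defined_def Let_def
    by (intro bexI [of _ "\<lambda>cs. word_val D C m (rep cs)"] ballI)
qed

text \<open>
  Replacing the entry \<open>u\<close> of the word \<open>m\<epsilon>m'\<close> by \<open>1\<close> does not change the value, and a symbol
  with an argument \<open>1\<close> has the value \<open>1\<close>.
\<close>

lemma symbol_val_in_Ann_series_if_class_I: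
  assumes "class_I s D C" and r: "1 \<le> r" "r \<le> s"
    and u: "u \<in> Ann_series D C s" and v: "v \<in> word_values D C (r - 1)"
  shows "symbol_val D C \<epsilon> u v \<in> Ann_series D C (s - r)"
proof -
  let ?N = "Ann_series D C s"
  obtain m' bs where m': "length m' = r - 1" "bs \<in> tuples (carrier D) r" "v = word_val D C m' bs"
    using v r by (auto simp: word_values_eq)
  have vc: "v \<in> carrier D"
    using m' word_val_closed [of bs m'] r by simp
  have uc: "u \<in> carrier D"
    using u by (rule Ann_series_closed)
  show ?thesis
  proof (rule Ann_series_if_words_vanish)
    show "symbol_val D C \<epsilon> u v \<in> carrier D"
      using uc vc by simp
    fix m :: "comm_symbol list" and as
    assume m: "length m = s - r" "as \<in> tuples (carrier D) (s - r)"
    let ?w = "m @ \<epsilon> # m'"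
    have w: "phi_well_defined D C ?w" "length ?w = s"
      using assms(1) m m' r by (auto simp: class_I_def)
    have val: "word_val D C ?w (as @ x # bs) = word_val D C m (as @ [symbol_val D C \<epsilon> x v])" for x
      using m m' word_val_append [of as m "\<epsilon> # m'" "x # bs"] by (simp add: tuples_def)
    have "?N #>\<^bsub>D\<^esub> u = ?N #>\<^bsub>D\<^esub> \<one>\<^bsub>D\<^esub>"
      using u uc coset_eq_self_iff [OF Ann_series_ideal] subgroup.one_closed [OF Ann_series_subgroup]
      by (metis dot.one_closed)
    then have "map (\<lambda>a. ?N #>\<^bsub>D\<^esub> a) (as @ u # bs) = map (\<lambda>a. ?N #>\<^bsub>D\<^esub> a) (as @ \<one>\<^bsub>D\<^esub> # bs)"
      by (simp only: map_append list.map)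
    moreover have "as @ x # bs \<in> tuples (carrier D) (s + 1)" if "x \<in> carrier D" for x
      using that m(2) m'(2) r by (simp add: tuples_def)
    ultimately have "word_val D C ?w (as @ u # bs) = word_val D C ?w (as @ \<one>\<^bsub>D\<^esub> # bs)"
      using w(1) uc dot.one_closed unfolding phi_well_defined_iff w(2) by blast
    then show "word_val D C m (as @ [symbol_val D C \<epsilon> u v]) = \<one>\<^bsub>D\<^esub>"
      using m vc word_val_one [of as m] by (simp add: val tuples_def)
  qed
qed

text \<open>
  Fixing \<open>s\<close> and weakening the congruence of the values by one step of the series for every symbol
  lets the induction run over words of all degrees up to \<open>s\<close>, although only those of degree \<open>s\<close>
  matter in the end.
\<close>

lemma word_val_cong_if_symbol_val_in_Ann_series:
  assumes crit: "\<And>\<epsilon> r u v. \<lbrakk>1 \<le> r; r \<le> s; u \<in> Ann_series D C s; v \<in> word_values D C (r - 1)\<rbrakk>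
      \<Longrightarrow> symbol_val D C \<epsilon> u v \<in> Ann_series D C (s - r)"
    and "length m \<le> s"
    and "as \<in> tuples (carrier D) (length m + 1)" "bs \<in> tuples (carrier D) (length m + 1)"
    and "map (\<lambda>a. Ann_series D C s #>\<^bsub>D\<^esub> a) as = map (\<lambda>a. Ann_series D C s #>\<^bsub>D\<^esub> a) bs"
  shows "Ann_series D C (s - length m) #>\<^bsub>D\<^esub> word_val D C m as
       = Ann_series D C (s - length m) #>\<^bsub>D\<^esub> word_val D C m bs"
  using assms(2-)
proof (induction m arbitrary: as bs)
  case Nil
  then show ?case
    by (cases as; cases bs) (auto simp: tuples_def)
next
  case (Cons \<epsilon> m)
  let ?r = "Suc (length m)"
  let ?K = "Ann_series D C (s - ?r)"
  let ?L = "Ann_series D C (s - length m)"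
  obtain a as' b bs' where eq: "as = a # as'" "bs = b # bs'"
    using Cons.prems by (cases as; cases bs) (auto simp: tuples_def)
  have ab: "a \<in> carrier D" "b \<in> carrier D" "Ann_series D C s #>\<^bsub>D\<^esub> a = Ann_series D C s #>\<^bsub>D\<^esub> b"
    and tup: "as' \<in> tuples (carrier D) (length m + 1)" "bs' \<in> tuples (carrier D) (length m + 1)"
    using Cons.prems by (auto simp: eq tuples_def)
  define v where "v = word_val D C m as'"
  define w where "w = word_val D C m bs'"
  have vw: "v \<in> carrier D" "w \<in> carrier D"
    using tup by (simp_all add: v_def w_def word_val_closed)
  have vS: "v \<in> word_values D C (length m)"
    using tup by (auto simp: v_def word_values_eq)
  \<comment> \<open>The first entry changes modulo the \<open>s\<close>-th term, which is where the hypothesis enters.\<close>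
  have "?K #>\<^bsub>D\<^esub> symbol_val D C \<epsilon> a v = ?K #>\<^bsub>D\<^esub> symbol_val D C \<epsilon> b v"
    using crit [of ?r] vS Cons.prems(1)
    by (intro symbol_val_cong [OF Ann_series_ideal Ann_series_ideal ab vw(1)]) simp
  \<comment> \<open>The inner value changes modulo the term just above \<open>?K\<close>, which every symbol sends into \<open>?K\<close>.\<close>
  also have "\<dots> = ?K #>\<^bsub>D\<^esub> symbol_val D C \<epsilon> b w"
  proof -
    have L: "?L #>\<^bsub>D\<^esub> v = ?L #>\<^bsub>D\<^esub> w"
      unfolding v_def w_def using Cons.prems tup by (intro Cons.IH) (auto simp: eq)
    have Suc: "s - length m = Suc (s - ?r)"
      using Cons.prems(1) by simp
    have "symbol_val D C \<epsilon>' x b \<in> ?K" if "x \<in> ?L" for x \<epsilon>'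
      using that ab(2) unfolding Suc Ann_series_Suc_iff by blast
    from symbol_val_cong [OF Ann_series_ideal Ann_series_ideal vw L ab(2) this, of "opposite \<epsilon>"]
    show ?thesis
      by (simp add: symbol_val_opposite)
  qed
  finally show ?case
    by (simp add: eq v_def w_def)
qed

end

theorem theorem4p8:
  fixes D C :: "'a monoid" and n :: nat
  assumes "skew_brace D C" and "n \<ge> 1"
  shows "class_I_bar n D C \<longleftrightarrow>
    (\<forall>\<epsilon> r s. 1 \<le> r \<and> r \<le> s \<and> s \<le> n \<longrightarrow>
      (\<forall>u \<in> Ann_series D C s. \<forall>v \<in> word_values D C (r - 1).
        symbol_val D C \<epsilon> u v \<in> Ann_series D C (s - r)))"
proof -
  interpret skew_brace D C
    by (rule assms(1))
  show ?thesis
  proof (intro iffI allI impI ballI)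
    fix \<epsilon> r s u v
    assume "class_I_bar n D C" and rs: "1 \<le> r \<and> r \<le> s \<and> s \<le> n"
      and uv: "u \<in> Ann_series D C s" "v \<in> word_values D C (r - 1)"
    then have "class_I s D C"
      by (simp add: class_I_bar_def)
    then show "symbol_val D C \<epsilon> u v \<in> Ann_series D C (s - r)"
      using rs uv by (intro symbol_val_in_Ann_series_if_class_I) auto
  next
    assume crit: "\<forall>\<epsilon> r s. 1 \<le> r \<and> r \<le> s \<and> s \<le> n \<longrightarrow>
      (\<forall>u \<in> Ann_series D C s. \<forall>v \<in> word_values D C (r - 1).
        symbol_val D C \<epsilon> u v \<in> Ann_series D C (s - r))"
    have "phi_well_defined D C m" if m: "length m \<le> n" for m
      unfolding phi_well_defined_iff
    proof (intro ballI impI)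
      fix as bs
      assume "as \<in> tuples (carrier D) (length m + 1)" "bs \<in> tuples (carrier D) (length m + 1)"
        and "map (\<lambda>a. Ann_series D C (length m) #>\<^bsub>D\<^esub> a) as
           = map (\<lambda>a. Ann_series D C (length m) #>\<^bsub>D\<^esub> a) bs"
      with word_val_cong_if_symbol_val_in_Ann_series [of "length m" m as bs] crit m
      have "{\<one>\<^bsub>D\<^esub>} #>\<^bsub>D\<^esub> word_val D C m as = {\<one>\<^bsub>D\<^esub>} #>\<^bsub>D\<^esub> word_val D C m bs"
        by simp
      then show "word_val D C m as = word_val D C m bs"
        using \<open>as \<in> _\<close> \<open>bs \<in> _\<close> by (simp add: r_coset_def word_val_closed)
    qed
    then show "class_I_bar n D C"
      using assms(1) by (simp add: class_I_bar_def class_I_def)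
  qed
qed

end
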